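(* Let $n\ge 1$, let $x_1\neq x_2$ be two vectors in $\mathbb{R}^n$, let $\alpha,\beta>0$, and let $Q_1,Q_2\in\mathbb{R}^{n\times n}$ be two symmetric positive definite matrices. Consider the bi-objective minimization problem $(f_1,f_2)$ on $\mathbb{R}^n$ with $$f_1(x)=\frac1\alpha (x-x_1)^\top Q_1(x-x_1),\qquad f_2(x)=\frac1\beta (x-x_2)^\top Q_2(x-x_2).$$ If $f_1$ and $f_2$ have proportional Hessian matrices, then the Pareto set of $(f_1,f_2)$ is the line segment between $x_1$ and $x_2$.
   Context: The Pareto set of a bi-objective minimization problem $(f_1,f_2)$ on $\mathbb{R}^n$ is the set of all $x\in\mathbb{R}^n$ for which there is no $y\in\mathbb{R}^n$ with $f_1(y)\le f_1(x)$ and $f_2(y)\le f_2(x)$ and at least one of these inequalities strict. Proportional Hessian matrices means that there is a real $\gamma$ with $\frac{Q_1}{\alpha}=\gamma\frac{Q_2}{\beta}$. The line segment between $x_1$ and $x_2$ is the closed segment $\{(1-s)x_1+sx_2 : s\in[0,1]\}$. *)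

theory Defs
  imports "HOL-Analysis.Analysis"
begin

definition pareto_set :: "('a \<Rightarrow> real) \<Rightarrow> ('a \<Rightarrow> real) \<Rightarrow> 'a set" where
  "pareto_set f1 f2 =
     {x. \<not> (\<exists>y. f1 y \<le> f1 x \<and> f2 y \<le> f2 x \<and> (f1 y < f1 x \<or> f2 y < f2 x))}"

definition sym_pos_def :: "real^'n^'n \<Rightarrow> bool" where
  "sym_pos_def Q \<longleftrightarrow> transpose Q = Q \<and> (\<forall>v. v \<noteq> 0 \<longrightarrow> v \<bullet> (Q *v v) > 0)"

definition quadratic_objective :: "real \<Rightarrow> real^'n^'n \<Rightarrow> real^'n \<Rightarrow> real^'n \<Rightarrow> real" where
  "quadratic_objective \<alpha> Q c x = (1 / \<alpha>) * ((x - c) \<bullet> (Q *v (x - c)))"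

text \<open>For symmetric \<open>Q\<close>, the Hessian of \<open>quadratic_objective \<alpha> Q c\<close> is \<open>(2 / \<alpha>) *\<^sub>R Q\<close>; the
  factor 2 is common to both objectives and is dropped here.\<close>

definition proportional_hessians ::
    "real \<Rightarrow> real^'n^'n \<Rightarrow> real \<Rightarrow> real^'n^'n \<Rightarrow> bool" where
  "proportional_hessians \<alpha> Q1 \<beta> Q2 \<longleftrightarrow>
     (\<exists>\<gamma>::real. (1 / \<alpha>) *\<^sub>R Q1 = \<gamma> *\<^sub>R ((1 / \<beta>) *\<^sub>R Q2))"

end

theory Submission
  imports Defs
begin

text \<open>Up to positive factors, both objectives are squared distances to \<open>x1\<close> and \<open>x2\<close> for one and
  the same inner product. A convex combination of these squared distances is, up to a constant, the
  squared distance to a point of the segment, so a point of the segment is weakly dominated only by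
  itself. Conversely, projecting onto the line through \<open>x1\<close> and \<open>x2\<close> and clamping the parameter to
  \<open>[0, 1]\<close> yields a point of the segment that weakly dominates a given point.\<close>

lemma pareto_set_scale:
  assumes "a > 0" "b > 0"
  shows "pareto_set (\<lambda>x. a * f x) (\<lambda>x. b * g x) = pareto_set f g"
  using assms by (simp add: pareto_set_def)

lemma sym_pos_def_comm:
  assumes "sym_pos_def Q"
  shows "v \<bullet> (Q *v u) = u \<bullet> (Q *v v)"
  using assms by (metis sym_pos_def_def dot_lmul_matrix inner_commute transpose_matrix_vector)

lemma quadratic_form_add_scaled:
  assumes "sym_pos_def Q"
  shows "(u + r *\<^sub>R v) \<bullet> (Q *v (u + r *\<^sub>R v)) =
    u \<bullet> (Q *v u) + 2 * r * (u \<bullet> (Q *v v)) + r\<^sup>2 * (v \<bullet> (Q *v v))"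
  using sym_pos_def_comm[OF assms, of v u]
  by (simp add: matrix_vector_right_distrib matrix_vector_mult_scaleR inner_add_left
      inner_add_right power2_eq_square algebra_simps)

lemma quadratic_form_nonneg:
  assumes "sym_pos_def Q"
  shows "v \<bullet> (Q *v v) \<ge> 0"
  using assms unfolding sym_pos_def_def by (cases "v = 0") (auto intro: less_imp_le)

text \<open>Expand both forms around \<open>p\<close>: the cross terms carry
  \<open>(1 - s) * s + s * (s - 1) = 0\<close> and cancel, while the squares carry
  \<open>(1 - s) * s\<^sup>2 + s * (s - 1)\<^sup>2 = s * (1 - s)\<close>.\<close>

lemma quadratic_form_convex_combination:
  assumes "sym_pos_def Q" and p: "p = (1 - s) *\<^sub>R a + s *\<^sub>R b"
  shows "(1 - s) * ((y - a) \<bullet> (Q *v (y - a))) + s * ((y - b) \<bullet> (Q *v (y - b))) =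
    (y - p) \<bullet> (Q *v (y - p)) + s * (1 - s) * ((b - a) \<bullet> (Q *v (b - a)))"
proof -
  have a: "y - a = (y - p) + s *\<^sub>R (b - a)" and b: "y - b = (y - p) + (s - 1) *\<^sub>R (b - a)"
    by (simp_all add: p algebra_simps)
  show ?thesis
    unfolding a b quadratic_form_add_scaled[OF assms(1)]
    by (simp add: power2_eq_square algebra_simps)
qed

lemma segment_weakly_dominated_unique:
  assumes Q: "sym_pos_def Q" and "p \<in> closed_segment a b"
    and le_a: "(y - a) \<bullet> (Q *v (y - a)) \<le> (p - a) \<bullet> (Q *v (p - a))"
    and le_b: "(y - b) \<bullet> (Q *v (y - b)) \<le> (p - b) \<bullet> (Q *v (p - b))"
  shows "y = p"
proof (rule ccontr)
  assume "y \<noteq> p"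
  then have "(y - p) \<bullet> (Q *v (y - p)) > 0"
    using Q by (simp add: sym_pos_def_def)
  moreover obtain s where s: "0 \<le> s" "s \<le> 1" and p: "p = (1 - s) *\<^sub>R a + s *\<^sub>R b"
    using assms(2) by (auto simp: closed_segment_def)
  moreover have "(1 - s) * ((y - a) \<bullet> (Q *v (y - a))) + s * ((y - b) \<bullet> (Q *v (y - b)))
      \<le> (1 - s) * ((p - a) \<bullet> (Q *v (p - a))) + s * ((p - b) \<bullet> (Q *v (p - b)))"
    using s le_a le_b by (intro add_mono mult_left_mono) auto
  \<comment> \<open>The identity at \<open>y\<close> and at \<open>p\<close> has the same constant
    term, and the form vanishes at \<open>p - p\<close>, so the form at \<open>y - p\<close> would
    be at most 0. Strictness comes from this term, so an endpoint, where one weight is 0, needs no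
    separate case.\<close>
  ultimately show False
    using quadratic_form_convex_combination[OF Q p, of y]
      quadratic_form_convex_combination[OF Q p, of p] by simp
qed

lemma exists_segment_weakly_dominating:
  assumes Q: "sym_pos_def Q" and "a \<noteq> b"
  obtains p where "p \<in> closed_segment a b"
    "(p - a) \<bullet> (Q *v (p - a)) \<le> (x - a) \<bullet> (Q *v (x - a))"
    "(p - b) \<bullet> (Q *v (p - b)) \<le> (x - b) \<bullet> (Q *v (x - b))"
proof -
  define q where "q v = v \<bullet> (Q *v v)" for v
  define d where "d = b - a"
  \<comment> \<open>\<open>a + t *\<^sub>R d\<close> is the \<open>Q\<close>-orthogonal projection
    of \<open>x\<close> onto the line, and \<open>w\<close> below is the component of
    \<open>x - a\<close> orthogonal to \<open>d\<close>.\<close>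
  define t where "t = (x - a) \<bullet> (Q *v d) / q d"
  define s where "s = max 0 (min 1 t)"
  define w where "w = x - a - t *\<^sub>R d"
  have q_add: "q (u + r *\<^sub>R v) = q u + 2 * r * (u \<bullet> (Q *v v)) + r\<^sup>2 * q v" for u v r
    unfolding q_def by (rule quadratic_form_add_scaled[OF Q])
  have qd: "q d > 0"
    using assms by (simp add: q_def d_def sym_pos_def_def)
  have orth: "w \<bullet> (Q *v d) = 0"
    using qd by (simp add: w_def t_def inner_diff_left flip: q_def)
  have q_line: "q (w + r *\<^sub>R d) \<ge> r\<^sup>2 * q d" for r
    using quadratic_form_nonneg[OF Q, of w] by (simp add: q_add orth flip: q_def)
  have q_scale: "q (r *\<^sub>R d) = r\<^sup>2 * q d" for r
    using q_add[of 0 r d] by (simp add: q_def)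
  \<comment> \<open>Clamping to \<open>[0, 1]\<close> moves \<open>t\<close> no further from either
    of the parameters 0 and 1, which belong to \<open>a\<close> and \<open>b\<close>.\<close>
  have "s\<^sup>2 \<le> t\<^sup>2" "(s - 1)\<^sup>2 \<le> (t - 1)\<^sup>2"
    by (auto simp: s_def max_def min_def abs_le_square_iff[symmetric])
  then have le: "q (s *\<^sub>R d) \<le> q (w + t *\<^sub>R d)"
      "q ((s - 1) *\<^sub>R d) \<le> q (w + (t - 1) *\<^sub>R d)"
    using qd q_line[of t] q_line[of "t - 1"] unfolding q_scale
    by (meson mult_right_mono less_imp_le order_trans)+
  show thesis
  proof (rule that)
    show "a + s *\<^sub>R d \<in> closed_segment a b"
      unfolding closed_segment_def
      by (intro CollectI exI[of _ s]) (auto simp: d_def s_def algebra_simps)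
    have "a + s *\<^sub>R d - a = s *\<^sub>R d" "x - a = w + t *\<^sub>R d"
      "a + s *\<^sub>R d - b = (s - 1) *\<^sub>R d" "x - b = w + (t - 1) *\<^sub>R d"
      by (simp_all add: w_def d_def algebra_simps)
    then show "(a + s *\<^sub>R d - a) \<bullet> (Q *v (a + s *\<^sub>R d - a)) \<le> (x - a) \<bullet> (Q *v (x - a))"
      "(a + s *\<^sub>R d - b) \<bullet> (Q *v (a + s *\<^sub>R d - b)) \<le> (x - b) \<bullet> (Q *v (x - b))"
      using le unfolding q_def by simp_all
  qed
qed

lemma pareto_set_common_quadratic_form:
  assumes Q: "sym_pos_def Q" and "a \<noteq> b"
  shows "pareto_set (\<lambda>x. (x - a) \<bullet> (Q *v (x - a))) (\<lambda>x. (x - b) \<bullet> (Q *v (x - b))) =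
    closed_segment a b" (is "?P = _")
proof
  show "closed_segment a b \<subseteq> ?P"
    using segment_weakly_dominated_unique[OF Q] by (fastforce simp: pareto_set_def)
  show "?P \<subseteq> closed_segment a b"
  proof
    fix x assume x: "x \<in> ?P"
    obtain p where p: "p \<in> closed_segment a b"
      "(p - a) \<bullet> (Q *v (p - a)) \<le> (x - a) \<bullet> (Q *v (x - a))"
      "(p - b) \<bullet> (Q *v (p - b)) \<le> (x - b) \<bullet> (Q *v (x - b))"
      using exists_segment_weakly_dominating[OF assms] .
    \<comment> \<open>Since \<open>p\<close> weakly dominates the Pareto point \<open>x\<close>,
      neither inequality is strict; hence \<open>x\<close> in turn weakly dominates
      \<open>p\<close>, and uniqueness applies.\<close>
    then have "x = p"
      using x by (intro segment_weakly_dominated_unique[OF Q p(1)])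
        (auto simp: pareto_set_def not_less)
    with p(1) show "x \<in> closed_segment a b" by simp
  qed
qed

theorem corollary1:
  fixes x1 x2 :: "real^'n"
    and Q1 Q2 :: "real^'n^'n"
    and \<alpha> \<beta> :: real
  assumes "x1 \<noteq> x2"
    and "\<alpha> > 0" and "\<beta> > 0"
    and "sym_pos_def Q1" and "sym_pos_def Q2"
    and "proportional_hessians \<alpha> Q1 \<beta> Q2"
  shows "pareto_set (quadratic_objective \<alpha> Q1 x1) (quadratic_objective \<beta> Q2 x2)
           = closed_segment x1 x2"
proof -
  obtain \<gamma> where \<gamma>: "(1 / \<alpha>) *\<^sub>R Q1 = \<gamma> *\<^sub>R ((1 / \<beta>) *\<^sub>R Q2)"
    using assms(6) by (auto simp: proportional_hessians_def)
  have form: "1 / \<alpha> * (v \<bullet> (Q1 *v v)) = \<gamma> / \<beta> * (v \<bullet> (Q2 *v v))" for v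
    using arg_cong[OF \<gamma>, of "\<lambda>M. v \<bullet> (M *v v)"]
    by (simp flip: scaleR_matrix_vector_assoc)
  \<comment> \<open>Proportionality leaves the sign of \<open>\<gamma>\<close> open; comparing both
    forms at the nonzero vector \<open>x1 - x2\<close> fixes it, so that
    \<open>\<gamma> / \<beta>\<close> is an admissible scaling factor.\<close>
  have "1 / \<alpha> * ((x1 - x2) \<bullet> (Q1 *v (x1 - x2))) > 0" "(x1 - x2) \<bullet> (Q2 *v (x1 - x2)) > 0"
    using assms(1,2,4,5) by (simp_all add: sym_pos_def_def)
  then have "\<gamma> / \<beta> > 0"
    unfolding form by (simp only: zero_less_mult_pos2)
  then show ?thesis
    unfolding quadratic_objective_def form
    by (subst pareto_set_scale) (simp_all add: assms(3) pareto_set_common_quadratic_form[OF assms(5,1)])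
qed

end
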